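(* Let $r\ge 1$, let $\mathbf a=(a_1,\ldots,a_r)$ be a sequence of positive integers, and let $D$ be a positive common multiple of $a_1,\ldots,a_r$. For the polynomial part $P_{\mathbf a}(n)$ of the quasi-polynomial $p_{\mathbf a}(n)$ we have $$ P_{\mathbf a}(n) = \frac{1}{D(r-1)!} \sum_{0\leq j_1\leq \frac{D}{a_1}-1,\ldots, 0\leq j_r\leq \frac{D}{a_r}-1} \ \prod_{\ell=1}^{r-1} \left(\frac{n-a_1j_{1}- \cdots -a_rj_r}{D}+\ell \right).$$
   Context: $p_{\mathbf a}(n)$ (the restricted partition function) is the number of integer solutions $(x_1,\ldots,x_r)$ of $\sum_{i=1}^r a_ix_i=n$ with all $x_i\ge 0$. It is a quasi-polynomial of period $D$ in $n\ge 0$, i.e. a polynomial in $n$ with $D$-periodic coefficients. Any quasi-polynomial $p:\mathbb N\to\mathbb C$ of period $D$ can be written uniquely as $p(n)=\sum_{\lambda^D=1}P_\lambda(n)\lambda^{-n}$ for all $n\ge 0$, where the sum is over the complex $D$-th roots of unity $\lambda$ and each $P_\lambda$ is a polynomial; the polynomial part of $p$ is by definition $P_1(n)$. Here $P_{\mathbf a}$ denotes the polynomial part of $p_{\mathbf a}$. An empty product equals $1$. *)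

theory Defs
  imports
    Complex_Main
    "HOL-Library.FuncSet"
    "HOL-Computational_Algebra.Polynomial"
begin

text \<open>
  A sequence $(a_1, \ldots, a_r)$ is given by \<open>r\<close> and a function \<open>a :: nat \<Rightarrow> nat\<close>, of which
  only the values on \<open>{1..r}\<close> matter; tuples are extensional functions on \<open>{1..r}\<close>, so
  that each tuple is counted once. The set below is finite if all \<open>a i\<close> are positive.
\<close>

definition restricted_partitions :: "nat \<Rightarrow> (nat \<Rightarrow> nat) \<Rightarrow> nat \<Rightarrow> nat" where
  "restricted_partitions r a n =
     card {x \<in> {1..r} \<rightarrow>\<^sub>E (UNIV :: nat set). (\<Sum>i=1..r. a i * x i) = n}"

definition quasi_poly_decomposition ::
  "nat \<Rightarrow> (nat \<Rightarrow> complex) \<Rightarrow> (complex \<Rightarrow> complex poly) \<Rightarrow> bool" where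
  "quasi_poly_decomposition D p P \<longleftrightarrow>
     (\<forall>n. p n = (\<Sum>z | z ^ D = 1. poly (P z) (of_nat n) * z powi (- int n)))"

text \<open>
  For \<open>D > 0\<close> and a quasi-polynomial \<open>p\<close> of period \<open>D\<close>, a decomposition exists and its
  polynomials at the \<open>D\<close>-th roots of unity are unique, so the description is proper. The
  values of \<open>P\<close> at other complex numbers play no role.
\<close>

definition polynomial_part :: "nat \<Rightarrow> (nat \<Rightarrow> complex) \<Rightarrow> complex poly" where
  "polynomial_part D p = (THE Q. \<exists>P. quasi_poly_decomposition D p P \<and> Q = P 1)"

end

theory Submission
  imports Defs
begin

text \<open>
  Division with remainder turns counting into stars and bars. Every \<open>x\<^sub>i\<close> is uniquely
  \<open>j\<^sub>i + (D / a\<^sub>i) q\<^sub>i\<close> with \<open>0 \<le> j\<^sub>i < D / a\<^sub>i\<close>, and this makes \<open>\<Sum> a\<^sub>i x\<^sub>i\<close> equal to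
  \<open>s(j) + D (q\<^sub>1 + \<dots> + q\<^sub>r)\<close> with \<open>s(j) = \<Sum> a\<^sub>i j\<^sub>i\<close>. So a tuple \<open>j\<close> contributes to
  \<open>p(n)\<close> only if \<open>D\<close> divides \<open>n - s(j)\<close>, and then it contributes the number of weak
  compositions of \<open>(n - s(j)) / D\<close> into \<open>r\<close> parts, which is
  \<open>\<Prod>\<^sub>l ((n - s(j)) / D + l) / (r - 1)!\<close> with \<open>l\<close> running over \<open>1, \<dots>, r - 1\<close>. The formula
  stays right when \<open>s(j) > n\<close>: as \<open>s(j) < r D\<close>, the negative integer \<open>(n - s(j)) / D\<close> is then
  one of \<open>-1, \<dots>, -(r - 1)\<close>, and one factor vanishes (lemma
  \<open>restricted_partitions_eq_sum\<close>).

  The condition that \<open>D\<close> divides \<open>n - s(j)\<close> is itself the average of \<open>z ^ (s(j) - n)\<close> over all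
  \<open>D\<close>-th roots of unity \<open>z\<close> (lemma \<open>sum_roots_unity_powi\<close>). Substituting it
  gives a decomposition of \<open>p\<close> whose polynomial at \<open>z = 1\<close> is the claimed right-hand side,
  and lemma \<open>quasi_poly_decomposition_unique\<close> shows that it is the polynomial part.
\<close>

section \<open>Orthogonality of roots of unity\<close>

lemma sum_powers_root_unity:
  fixes z :: "'a :: field"
  assumes "z ^ D = 1"
  shows "(\<Sum>c<D. z ^ c) = (if z = 1 then of_nat D else 0)"
  using assms by (auto simp: sum_gp_strict)

lemma power_int_mod_root_unity:
  fixes z :: "'a :: field"
  assumes "D > 0" "z ^ D = 1"
  shows "z powi k = z ^ nat (k mod int D)"
proof -
  have "z \<noteq> 0"
    using assms by (auto simp: zero_power)
  have "z powi k = z powi (int D * (k div int D) + k mod int D)"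
    by simp
  also have "\<dots> = (z powi int D) powi (k div int D) * z powi (k mod int D)"
    using \<open>z \<noteq> 0\<close> by (simp only: power_int_add power_int_mult simp_thms)
  also have "\<dots> = z powi (k mod int D)"
    using assms by simp
  also have "\<dots> = z ^ nat (k mod int D)"
    using assms by (simp add: power_int_def)
  finally show ?thesis .
qed

text \<open>
  The \<open>D\<close>-th roots of unity are the powers of \<open>w = cis (2 \<pi> / D)\<close>, so the sum is a geometric
  one with ratio \<open>w ^ k\<close>, itself a root of unity, which is \<open>1\<close> only if \<open>D\<close> divides \<open>k\<close>.
\<close>

lemma sum_roots_unity_powi:
  assumes "D > 0"
  shows "(\<Sum>z | z ^ D = 1. z powi k) = (if int D dvd k then of_nat D else (0 :: complex))"
proof -
  define c where "c = nat (k mod int D)"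
  define f where "f m = cis (2 * pi * real m / real D)" for m
  have bij: "bij_betw f {..<D} {z. z ^ D = 1}"
    unfolding f_def by (rule bij_betw_roots_unity[OF assms])
  have "c < D"
    using assms by (simp add: c_def nat_less_iff)
  have f_c: "f c = 1 \<longleftrightarrow> c = 0"
  proof -
    have "f c = f 0 \<longleftrightarrow> c = 0"
      using bij \<open>c < D\<close> assms by (intro inj_on_eq_iff[of f "{..<D}"]) (auto simp: bij_betw_def)
    then show ?thesis
      by (simp add: f_def)
  qed
  have "(\<Sum>z | z ^ D = 1. z powi k) = (\<Sum>z :: complex | z ^ D = 1. z ^ c)"
    unfolding c_def using assms by (intro sum.cong refl power_int_mod_root_unity) auto
  also have "\<dots> = (\<Sum>m<D. f m ^ c)"
    by (rule sum.reindex_bij_betw[OF bij, symmetric])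
  also have "\<dots> = (\<Sum>m<D. f c ^ m)"
    by (simp add: f_def DeMoivre mult_ac)
  also have "\<dots> = (if f c = 1 then of_nat D else 0)"
    using bij \<open>c < D\<close> by (intro sum_powers_root_unity) (auto simp: bij_betw_def)
  finally have "(\<Sum>z | z ^ D = 1. z powi k) = (if f c = 1 then of_nat D else (0 :: complex))" .
  moreover have "c = 0 \<longleftrightarrow> int D dvd k"
    using assms Euclidean_Rings.pos_mod_sign[of "int D" k]
    by (auto simp: c_def dvd_eq_mod_eq_0 intro: order_antisym)
  ultimately show ?thesis
    by (simp add: f_c)
qed

section \<open>Uniqueness of the decomposition of a quasi-polynomial\<close>

text \<open>
  On a residue class \<open>c\<close> modulo \<open>D\<close> the powers \<open>z ^ (-n)\<close> are constant, so a decomposition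
  becomes there an equality at infinitely many points between \<open>p\<close> and the polynomial
  \<open>\<Sum>\<^sub>z z ^ (-c) P\<^sub>z\<close>, which is thereby determined.
\<close>

lemma quasi_poly_decomposition_residue_class:
  assumes "D > 0"
    and "quasi_poly_decomposition D p P" "quasi_poly_decomposition D p Q"
  shows "(\<Sum>z | z ^ D = 1. smult (z powi (- int c)) (P z)) =
         (\<Sum>z | z ^ D = 1. smult (z powi (- int c)) (Q z))"
    (is "?L = ?R")
proof -
  have eval: "poly (\<Sum>z | z ^ D = 1. smult (z powi (- int c)) (F z)) (of_nat (c + D * m)) =
              p (c + D * m)"
    if "quasi_poly_decomposition D p F" for F m
  proof -
    have pw: "z powi (- int (c + D * m)) = z powi (- int c)" if "z ^ D = 1" for z :: complex
    proof -
      have "(- int (c + D * m)) mod int D = (- int c) mod int D"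
        by (simp add: mod_eq_dvd_iff)
      then show ?thesis
        using power_int_mod_root_unity[OF assms(1) that] by metis
    qed
    have "p (c + D * m) =
      (\<Sum>z | z ^ D = 1. poly (F z) (of_nat (c + D * m)) * z powi (- int (c + D * m)))"
      using that unfolding quasi_poly_decomposition_def by blast
    also have "\<dots> = (\<Sum>z | z ^ D = 1. poly (F z) (of_nat (c + D * m)) * z powi (- int c))"
      by (intro sum.cong refl) (simp only: mem_Collect_eq pw)
    finally show ?thesis
      by (simp add: poly_sum mult_ac)
  qed
  have "range (\<lambda>m. of_nat (c + D * m)) \<subseteq> {x. poly (?L - ?R) x = 0}"
    using eval[OF assms(2)] eval[OF assms(3)] by auto
  moreover have "infinite (range (\<lambda>m. of_nat (c + D * m) :: complex))"
    using assms(1) by (intro range_inj_infinite) (auto simp: inj_on_def simp flip: of_nat_mult of_nat_add)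
  ultimately have "infinite {x. poly (?L - ?R) x = 0}"
    by (rule infinite_super)
  then have "?L - ?R = 0"
    using poly_roots_finite by blast
  then show ?thesis
    by simp
qed

lemma smult_sum_right: "smult c (\<Sum>x\<in>A. f x) = (\<Sum>x\<in>A. smult c (f x))"
  by (induction A rule: infinite_finite_induct) (simp_all add: smult_add_right)

text \<open>
  Each residue class determines the polynomial \<open>\<Sum>\<^sub>z z ^ (-c) P\<^sub>z\<close>, and discrete Fourier
  inversion over the classes \<open>c\<close> recovers \<open>P\<^sub>w\<close> from these.
\<close>

lemma quasi_poly_decomposition_unique:
  assumes "D > 0"
    and "quasi_poly_decomposition D p P" "quasi_poly_decomposition D p Q"
    and "w ^ D = 1"
  shows "P w = Q w"
proof -
  have inversion:
    "(\<Sum>c<D. smult (w ^ c) (\<Sum>z | z ^ D = 1. smult (z powi (- int c)) (F z))) =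
     smult (of_nat D) (F w)" for F :: "complex \<Rightarrow> complex poly"
  proof -
    have "(\<Sum>c<D. smult (w ^ c) (\<Sum>z | z ^ D = 1. smult (z powi (- int c)) (F z))) =
          (\<Sum>c<D. \<Sum>z | z ^ D = 1. smult ((w / z) ^ c) (F z))"
      by (simp add: smult_sum_right power_int_minus power_divide flip: divide_inverse)
    also have "\<dots> = (\<Sum>z | z ^ D = 1. smult (\<Sum>c<D. (w / z) ^ c) (F z))"
      by (subst sum.swap) (simp add: smult_sum)
    also have "\<dots> = (\<Sum>z | z ^ D = 1. if z = w then smult (of_nat D) (F z) else 0)"
    proof (intro sum.cong refl)
      fix z :: complex
      assume z: "z \<in> {z. z ^ D = 1}"
      then have "z \<noteq> 0"
        using assms(1) by (auto simp: zero_power)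
      then have "w / z = 1 \<longleftrightarrow> z = w"
        by auto
      moreover have "(w / z) ^ D = 1"
        using z assms(4) by (simp add: power_divide)
      ultimately show "smult (\<Sum>c<D. (w / z) ^ c) (F z) =
          (if z = w then smult (of_nat D) (F z) else 0)"
        by (simp add: sum_powers_root_unity)
    qed
    also have "\<dots> = smult (of_nat D) (F w)"
      using assms(1,4) by (simp add: finite_roots_unity)
    finally show ?thesis .
  qed
  have "smult (of_nat D) (P w) = smult (of_nat D) (Q w)"
    using quasi_poly_decomposition_residue_class[OF assms(1-3)] by (simp flip: inversion)
  then have "smult (of_nat D) (P w - Q w) = 0"
    by (simp add: smult_diff_right)
  then show ?thesis
    using assms(1) by simp
qed

lemma polynomial_part_eq:
  assumes "D > 0" "quasi_poly_decomposition D p P"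
  shows "polynomial_part D p = P 1"
  unfolding polynomial_part_def
proof (rule the_equality)
  show "\<exists>P'. quasi_poly_decomposition D p P' \<and> P 1 = P' 1"
    using assms(2) by blast
next
  fix Q
  assume "\<exists>P'. quasi_poly_decomposition D p P' \<and> Q = P' 1"
  then show "Q = P 1"
    using quasi_poly_decomposition_unique[OF assms(1) _ assms(2)] by force
qed

section \<open>Counting by division with remainder\<close>

lemma finite_weak_compositions:
  assumes "finite I"
  shows "finite {q \<in> I \<rightarrow>\<^sub>E (UNIV :: nat set). sum q I = m}"
proof (rule finite_subset)
  show "{q \<in> I \<rightarrow>\<^sub>E UNIV. sum q I = m} \<subseteq> I \<rightarrow>\<^sub>E {..m}"
    using assms by (auto simp: PiE_def Pi_def intro: member_le_sum)
qed (use assms in \<open>simp add: finite_PiE\<close>)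

lemma card_weak_compositions:
  "card {q \<in> {1..r} \<rightarrow>\<^sub>E (UNIV :: nat set). sum q {1..r} = m} = (m + r - 1) choose m"
proof -
  have "bij_betw (\<lambda>q. map q [1..<Suc r])
          {q \<in> {1..r} \<rightarrow>\<^sub>E (UNIV :: nat set). sum q {1..r} = m}
          {xs. length xs = r \<and> sum_list xs = m}"
  proof (rule bij_betw_byWitness[where f' = "\<lambda>xs. \<lambda>i\<in>{1..r}. xs ! (i - 1)"], goal_cases)
    case 1
    show ?case
      by (auto simp: fun_eq_iff PiE_def extensional_def simp del: upt_Suc)
  next
    case 2
    show ?case
      by (auto intro!: nth_equalityI simp del: upt_Suc)
  next
    case 3
    show ?case
      by (auto simp: interv_sum_list_conv_sum_set_nat atLeastLessThanSuc_atLeastAtMost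
               simp del: upt_Suc)
  next
    case 4
    have "(\<Sum>i=1..length xs. xs ! (i - 1)) = sum_list xs" for xs :: "nat list"
      by (simp add: sum_list_sum_nth sum.atLeast1_atMost_eq atLeast0LessThan)
    then show ?case
      by auto
  qed
  then show ?thesis
    by (simp add: bij_betw_same_card card_length_sum_list)
qed

lemma fact_mult_binomial_eq_prod:
  assumes "r \<ge> 1"
  shows "fact (r - 1) * of_nat ((m + r - 1) choose m) =
         (\<Prod>l=1..r - 1. of_nat m + of_nat l :: 'a :: field_char_0)"
proof -
  have "(m + r - 1) choose m = (m + (r - 1)) choose (r - 1)"
    using assms binomial_symmetric[of m "m + r - 1"] by simp
  also have "(of_nat \<dots> :: 'a) = pochhammer (of_nat m + 1) (r - 1) / fact (r - 1)"
    by (simp add: binomial_gbinomial gbinomial_pochhammer')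
  also have "pochhammer (of_nat m + 1 :: 'a) (r - 1) = (\<Prod>l=1..r - 1. of_nat m + of_nat l)"
    by (simp add: pochhammer_prod prod.atLeast1_atMost_eq atLeast0LessThan add_ac)
  finally show ?thesis
    by simp
qed

text \<open>
  The fibre over \<open>j\<close> of the map that sends \<open>x\<close> to its tuple of remainders \<open>x\<^sub>i mod (D / a\<^sub>i)\<close> is
  parametrised by the tuple \<open>q\<close> of quotients. All \<open>q\<^sub>i\<close> get the same weight
  \<open>a\<^sub>i (D / a\<^sub>i) = D\<close>, so the fibre consists of weak compositions.
\<close>

lemma restricted_partitions_eq_sum_card:
  assumes pos: "\<And>i. i \<in> {1..r} \<Longrightarrow> a i > 0"
    and D: "D > 0"
    and dvd: "\<And>i. i \<in> {1..r} \<Longrightarrow> a i dvd D"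
  shows "restricted_partitions r a n =
    (\<Sum>j \<in> (\<Pi>\<^sub>E i\<in>{1..r}. {0..D div a i - 1}).
       card {q \<in> {1..r} \<rightarrow>\<^sub>E (UNIV :: nat set). (\<Sum>i=1..r. a i * j i) + D * sum q {1..r} = n})"
    (is "_ = (\<Sum>j\<in>?J. card (?Q j))")
proof -
  let ?X = "{x \<in> {1..r} \<rightarrow>\<^sub>E (UNIV :: nat set). (\<Sum>i=1..r. a i * x i) = n}"
  let ?join = "\<lambda>(j, q). \<lambda>i\<in>{1..r}. j i + (D div a i) * q i"
  let ?split = "\<lambda>x. (\<lambda>i\<in>{1..r}. x i mod (D div a i), \<lambda>i\<in>{1..r}. x i div (D div a i))"
  have dpos: "D div a i > 0" if "i \<in> {1..r}" for i
    using D pos[OF that] dvd[OF that] by (simp add: div_greater_zero_iff dvd_imp_le)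
  have weight: "(\<Sum>i=1..r. a i * (j i + (D div a i) * q i)) =
                (\<Sum>i=1..r. a i * j i) + D * sum q {1..r}" for j q :: "nat \<Rightarrow> nat"
  proof -
    have "a i * (j i + (D div a i) * q i) = a i * j i + D * q i" if "i \<in> {1..r}" for i
      using dvd[OF that] by (simp add: distrib_left flip: mult.assoc)
    then show ?thesis
      by (simp add: sum.distrib sum_distrib_left)
  qed
  have fin: "finite (?Q j)" for j
  proof (rule finite_subset)
    show "?Q j \<subseteq> {q \<in> {1..r} \<rightarrow>\<^sub>E UNIV. sum q {1..r} = (n - (\<Sum>i=1..r. a i * j i)) div D}"
      using D by auto
  qed (simp add: finite_weak_compositions)
  have "bij_betw ?join (SIGMA j:?J. ?Q j) ?X"
  proof (rule bij_betw_byWitness[where f' = ?split], goal_cases)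
    case 1
    have less: "j i < D div a i" if "j \<in> ?J" "i \<in> {1..r}" for j i
    proof -
      have "j i \<le> D div a i - 1"
        using that by (auto simp: PiE_def Pi_def)
      then show ?thesis
        using dpos[OF that(2)] by linarith
    qed
    show ?case
    proof (intro ballI)
      fix jq
      assume "jq \<in> (SIGMA j:?J. ?Q j)"
      then obtain j q where jq: "jq = (j, q)" "j \<in> ?J" "q \<in> {1..r} \<rightarrow>\<^sub>E UNIV"
        by auto
      have "(j i + D div a i * q i) mod (D div a i) = j i"
           "(j i + D div a i * q i) div (D div a i) = q i" if "i \<in> {1..r}" for i
        using less[OF jq(2) that] dpos[OF that] by simp_all
      then have "(\<lambda>i\<in>{1..r}. (j i + D div a i * q i) mod (D div a i)) = j"
                "(\<lambda>i\<in>{1..r}. (j i + D div a i * q i) div (D div a i)) = q"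
        using jq(2,3) by (auto simp: fun_eq_iff PiE_def extensional_def)
      then show "?split (?join jq) = jq"
        by (simp add: jq(1) cong: restrict_cong)
    qed
  next
    case 2
    show ?case
    proof (intro ballI ext)
      fix x i
      assume "x \<in> ?X"
      then have "x i = undefined" if "i \<notin> {1..r}"
        using that by (blast intro: PiE_arb)
      then show "?join (?split x) i = x i"
        by (simp add: restrict_def del: atLeastAtMost_iff)
    qed
  next
    case 3
    show ?case
    proof (rule image_subsetI)
      fix jq
      assume "jq \<in> (SIGMA j:?J. ?Q j)"
      then obtain j q where jq: "jq = (j, q)" and n: "(\<Sum>i=1..r. a i * j i) + D * sum q {1..r} = n"
        by auto
      have "(\<Sum>i=1..r. a i * ?join jq i) = n"
        using weight[of j q] n by (simp add: jq)
      then show "?join jq \<in> ?X"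
        by (simp add: jq)
    qed
  next
    case 4
    show ?case
    proof (rule image_subsetI)
      fix x
      assume x: "x \<in> ?X"
      have "x i mod (D div a i) \<in> {0..D div a i - 1}" if "i \<in> {1..r}" for i
        using mod_less_divisor[OF dpos[OF that], of "x i"] by auto
      moreover have "(\<Sum>i=1..r. a i * (x i mod (D div a i))) + D * (\<Sum>i=1..r. x i div (D div a i)) = n"
        using x weight[of "\<lambda>i. x i mod (D div a i)" "\<lambda>i. x i div (D div a i)"] by simp
      ultimately show "?split x \<in> (SIGMA j:?J. ?Q j)"
        by simp
    qed
  qed
  then have "card ?X = card (SIGMA j:?J. ?Q j)"
    by (simp add: bij_betw_same_card)
  also have "\<dots> = (\<Sum>j\<in>?J. card (?Q j))"
    using fin by (intro card_SigmaI) (simp_all add: finite_PiE)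
  finally show ?thesis
    by (simp add: restricted_partitions_def)
qed

text \<open>
  The bound \<open>s < r D\<close> makes one formula serve all \<open>n\<close>: where there is nothing to count because
  \<open>n < s\<close>, the product vanishes by itself. The polynomial identity for the polynomial part
  rests on this, since it cannot contain the condition \<open>s \<le> n\<close>.
\<close>

lemma fact_mult_card_eq_prod:
  assumes "r \<ge> 1" "D > 0" "s < r * D"
  shows "fact (r - 1) *
      of_nat (card {q \<in> {1..r} \<rightarrow>\<^sub>E (UNIV :: nat set). s + D * sum q {1..r} = n}) =
    (if int D dvd int s - int n
     then \<Prod>l=1..r - 1. (of_nat n - of_nat s) / of_nat D + of_nat l
     else (0 :: 'a :: field_char_0))"
    (is "fact (r - 1) * of_nat (card ?Q) = _")
proof (cases "int D dvd int s - int n")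
  case False
  have "?Q = {}"
  proof (rule ccontr)
    assume "?Q \<noteq> {}"
    then obtain q :: "nat \<Rightarrow> nat" where "s + D * sum q {1..r} = n"
      by blast
    then have "int s - int n = int D * - int (sum q {1..r})"
      by (simp add: algebra_simps flip: of_nat_mult of_nat_add of_nat_sum)
    then show False
      using False by (metis dvd_triv_left)
  qed
  with False show ?thesis
    by (simp only: card.empty of_nat_0 mult_zero_right if_False)
next
  case True
  then obtain k where k: "int s - int n = int D * k" ..
  have quot: "(of_nat n - of_nat s) / of_nat D = (of_int (- k) :: 'a)"
  proof -
    have "of_int (int n - int s) = (of_int (int D * - k) :: 'a)"
      using k by (intro arg_cong[where f = of_int]) (simp add: algebra_simps)
    then show ?thesis
      using assms(2) by (simp add: field_simps)
  qed
  show ?thesis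
  proof (cases "k \<le> 0")
    case True
    define m where "m = nat (- k)"
    have "n = s + D * m"
    proof -
      have "int n = int (s + D * m)"
        using k True by (simp add: m_def)
      then show ?thesis
        by (simp only: of_nat_eq_iff)
    qed
    then have "?Q = {q \<in> {1..r} \<rightarrow>\<^sub>E UNIV. sum q {1..r} = m}"
      using assms(2) by auto
    then have "fact (r - 1) * of_nat (card ?Q) = (\<Prod>l=1..r - 1. of_nat m + of_nat l :: 'a)"
      using assms(1) by (simp only: card_weak_compositions fact_mult_binomial_eq_prod)
    also have "of_nat m = (of_int (- k) :: 'a)"
      using True by (simp add: m_def)
    finally show ?thesis
      using \<open>int D dvd int s - int n\<close> by (simp only: quot if_True)
  next
    case False
    have "s > n"
    proof -
      have "int D * k > 0"
        using False assms(2) by simp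
      then show ?thesis
        using k by linarith
    qed
    then have "?Q = {}"
      by auto
    \<comment> \<open>The factor of index \<open>k\<close> is zero, and the bound on \<open>s\<close> puts \<open>k\<close> into the index range.\<close>
    have "int D * k < int D * int r"
    proof -
      have "int s < int (r * D)"
        using assms(3) by (simp only: of_nat_less_iff)
      then show ?thesis
        using k by (simp add: mult_ac)
    qed
    then have "k < int r"
      using assms(2) by simp
    then have "nat k \<in> {1..r - 1}"
      using False by auto
    moreover have "of_int (- k) + of_nat (nat k) = (0 :: 'a)"
      using False by simp
    ultimately have "(\<Prod>l=1..r - 1. of_int (- k) + of_nat l) = (0 :: 'a)"
      by (intro prod_zero) (auto simp del: of_int_minus)
    with \<open>?Q = {}\<close> show ?thesis
      by (simp only: quot card.empty of_nat_0 mult_zero_right if_cancel)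
  qed
qed

lemma sum_remainders_less:
  fixes r D :: nat and a j :: "nat \<Rightarrow> nat"
  assumes "r \<ge> 1"
    and pos: "\<And>i. i \<in> {1..r} \<Longrightarrow> a i > 0"
    and D: "D > 0"
    and dvd: "\<And>i. i \<in> {1..r} \<Longrightarrow> a i dvd D"
    and j: "j \<in> (\<Pi>\<^sub>E i\<in>{1..r}. {0..D div a i - 1})"
  shows "(\<Sum>i=1..r. a i * j i) < r * D"
proof -
  have "a i * j i < D" if "i \<in> {1..r}" for i
  proof -
    have "j i \<le> D div a i - 1"
      using j that by (auto simp: PiE_def Pi_def)
    moreover have "D div a i > 0"
      using D pos[OF that] dvd[OF that] by (simp add: div_greater_zero_iff dvd_imp_le)
    ultimately have "j i < D div a i"
      by linarith
    then have "a i * j i < a i * (D div a i)"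
      using pos[OF that] by simp
    then show ?thesis
      using dvd[OF that] by simp
  qed
  then have "(\<Sum>i=1..r. a i * j i) < (\<Sum>i=1..r. D)"
    using assms(1) by (intro sum_strict_mono) auto
  then show ?thesis
    by simp
qed

lemma restricted_partitions_eq_sum:
  assumes "r \<ge> 1"
    and "\<And>i. i \<in> {1..r} \<Longrightarrow> a i > 0"
    and "D > 0"
    and "\<And>i. i \<in> {1..r} \<Longrightarrow> a i dvd D"
  shows "fact (r - 1) * of_nat (restricted_partitions r a n) =
    (\<Sum>j \<in> (\<Pi>\<^sub>E i\<in>{1..r}. {0..D div a i - 1}).
       if int D dvd int (\<Sum>i=1..r. a i * j i) - int n
       then \<Prod>l=1..r - 1. (of_nat n - of_nat (\<Sum>i=1..r. a i * j i)) / of_nat D + of_nat l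
       else (0 :: 'a :: field_char_0))"
proof -
  let ?J = "\<Pi>\<^sub>E i\<in>{1..r}. {0..D div a i - 1}"
  let ?Q = "\<lambda>j. {q \<in> {1..r} \<rightarrow>\<^sub>E (UNIV :: nat set). (\<Sum>i=1..r. a i * j i) + D * sum q {1..r} = n}"
  have "restricted_partitions r a n = (\<Sum>j\<in>?J. card (?Q j))"
    using assms(2-4) by (rule restricted_partitions_eq_sum_card)
  then have "fact (r - 1) * of_nat (restricted_partitions r a n) =
      (\<Sum>j\<in>?J. fact (r - 1) * of_nat (card (?Q j)) :: 'a)"
    by (simp only: of_nat_sum sum_distrib_left[where A = ?J])
  also have "\<dots> = (\<Sum>j\<in>?J.
       if int D dvd int (\<Sum>i=1..r. a i * j i) - int n
       then \<Prod>l=1..r - 1. (of_nat n - of_nat (\<Sum>i=1..r. a i * j i)) / of_nat D + of_nat l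
       else 0)"
    by (intro sum.cong refl fact_mult_card_eq_prod sum_remainders_less assms)
  finally show ?thesis .
qed

section \<open>The polynomial part\<close>

theorem corollary2p6:
  fixes r D :: nat and a :: "nat \<Rightarrow> nat" and n :: complex
  assumes "r \<ge> 1"
    and "\<And>i. i \<in> {1..r} \<Longrightarrow> a i > 0"
    and "D > 0"
    and "\<And>i. i \<in> {1..r} \<Longrightarrow> a i dvd D"
  shows "poly (polynomial_part D (\<lambda>m. of_nat (restricted_partitions r a m))) n =
    1 / (of_nat D * fact (r - 1)) *
    (\<Sum>j \<in> (\<Pi>\<^sub>E i\<in>{1..r}. {0..D div a i - 1}).
       \<Prod>l=1..r - 1. ((n - (\<Sum>i=1..r. of_nat (a i) * of_nat (j i))) / of_nat D + of_nat l))"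
proof -
  let ?J = "\<Pi>\<^sub>E i\<in>{1..r}. {0..D div a i - 1}"
  define s where "s j = (\<Sum>i=1..r. a i * j i)" for j
  define A :: "(nat \<Rightarrow> nat) \<Rightarrow> complex poly" where
    "A j = (\<Prod>l=1..r - 1. [:of_nat l - of_nat (s j) / of_nat D, 1 / of_nat D:])" for j
  define P where
    "P z = smult (1 / (of_nat D * fact (r - 1))) (\<Sum>j\<in>?J. smult (z ^ s j) (A j))" for z
  have poly_A: "poly (A j) x = (\<Prod>l=1..r - 1. (x - of_nat (s j)) / of_nat D + of_nat l)" for j x
    by (simp add: A_def poly_prod diff_divide_distrib algebra_simps)
  have "quasi_poly_decomposition D (\<lambda>m. of_nat (restricted_partitions r a m)) P"
    unfolding quasi_poly_decomposition_def
  proof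
    fix m
    have term_eq: "poly (P z) (of_nat m) * z powi (- int m) = 1 / (of_nat D * fact (r - 1)) *
        (\<Sum>j\<in>?J. poly (A j) (of_nat m) * z powi (int (s j) - int m))"
      if "z ^ D = 1" for z
    proof -
      have "z \<noteq> 0"
        using that assms(3) by (auto simp: zero_power)
      then have "z powi (int (s j) - int m) = z ^ s j * z powi (- int m)" for j
        by (simp add: power_int_diff power_int_minus divide_inverse)
      then show ?thesis
        by (simp add: P_def poly_sum sum_distrib_left sum_distrib_right mult_ac)
    qed
    have "(\<Sum>z | z ^ D = 1. poly (P z) (of_nat m) * z powi (- int m)) =
        (\<Sum>z | z ^ D = 1. 1 / (of_nat D * fact (r - 1)) *
          (\<Sum>j\<in>?J. poly (A j) (of_nat m) * z powi (int (s j) - int m)))"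
      by (intro sum.cong refl term_eq) simp
    also have "\<dots> = 1 / (of_nat D * fact (r - 1)) *
        (\<Sum>j\<in>?J. \<Sum>z | z ^ D = 1. poly (A j) (of_nat m) * z powi (int (s j) - int m))"
      by (subst sum.swap) (simp only: sum_distrib_left)
    also have "\<dots> = 1 / (of_nat D * fact (r - 1)) *
        (\<Sum>j\<in>?J. of_nat D * (if int D dvd int (s j) - int m then poly (A j) (of_nat m) else 0))"
      by (intro arg_cong2[where f = "(*)"] sum.cong refl)
         (simp add: sum_roots_unity_powi[OF assms(3)] flip: sum_distrib_left)
    also have "\<dots> = 1 / fact (r - 1) *
        (\<Sum>j\<in>?J. if int D dvd int (s j) - int m then poly (A j) (of_nat m) else 0)"
      using assms(3) by (subst sum_distrib_left[symmetric]) simp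
    also have "\<dots> = 1 / fact (r - 1) * (fact (r - 1) * of_nat (restricted_partitions r a m))"
      unfolding poly_A s_def by (subst restricted_partitions_eq_sum[OF assms]) simp_all
    finally show "of_nat (restricted_partitions r a m) =
        (\<Sum>z | z ^ D = 1. poly (P z) (of_nat m) * z powi (- int m))"
      by simp
  qed
  then have "polynomial_part D (\<lambda>m. of_nat (restricted_partitions r a m)) = P 1"
    by (rule polynomial_part_eq[OF assms(3)])
  then show ?thesis
    by (simp add: P_def poly_sum poly_A s_def)
qed

end
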